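(* Let $G$ be a simple graph of order $n$, where $n\geq 5$, and size at least $\binom{n}{2}-n+5$. Then $G$ has an orientation of diameter two.
   Context: An orientation of a graph $G$ is a digraph obtained by assigning a direction to every edge of $G$. The distance $d(u,v)$ in a digraph is the minimum length of a directed $(u,v)$-path (infinite if none exists), and the diameter is the maximum distance over all ordered pairs of vertices. *)

theory Defs
  imports "Graph_Theory.Pair_Digraph" "Graph_Theory.Shortest_Path"
begin

text \<open>
  A finite simple graph is a \<^locale>\<open>pair_graph\<close>: a finite, loop-free, symmetric digraph without
  parallel arcs. Every undirected edge is represented by two opposite arcs, so the size of the
  graph is the number of unordered pairs, not the number of arcs.
\<close>

definition edges :: "'a pair_pre_digraph \<Rightarrow> 'a set set" where
  "edges G = {{u, v} | u v. (u, v) \<in> parcs G}"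

definition is_orientation :: "'a pair_pre_digraph \<Rightarrow> 'a pair_pre_digraph \<Rightarrow> bool" where
  "is_orientation D G \<longleftrightarrow>
     pverts D = pverts G \<and> parcs D \<union> (parcs D)\<inverse> = parcs G \<and> parcs D \<inter> (parcs D)\<inverse> = {}"

text \<open>The infimum over the empty set is \<open>\<infinity>\<close> in \<^typ>\<open>enat\<close>.\<close>

definition digraph_dist :: "('a, 'b) pre_digraph \<Rightarrow> 'a \<Rightarrow> 'a \<Rightarrow> enat" where
  "digraph_dist D u v = (INF p \<in> {p. pre_digraph.apath D u p v}. enat (length p))"

definition digraph_diameter :: "('a, 'b) pre_digraph \<Rightarrow> enat" where
  "digraph_diameter D = (SUP u \<in> verts D. SUP v \<in> verts D. digraph_dist D u v)"

lemma is_orientation_iff: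
  assumes "pair_graph G"
  shows "is_orientation D G \<longleftrightarrow> pverts D = pverts G \<and> parcs D \<subseteq> parcs G \<and>
    (\<forall>u v. (u, v) \<in> parcs G \<longrightarrow> ((u, v) \<in> parcs D) \<noteq> ((v, u) \<in> parcs D))"
proof -
  interpret pair_graph G by fact
  have "sym (parcs G)"
    using pair_sym_arcs by (simp add: symmetric_def)
  then have sym: "(u, v) \<in> parcs G \<Longrightarrow> (v, u) \<in> parcs G" for u v
    by (rule symD)
  show ?thesis
  proof (intro iffI conjI allI impI; (elim conjE)?)
    assume D: "is_orientation D G"
    show "pverts D = pverts G" "parcs D \<subseteq> parcs G"
      using D by (auto simp: is_orientation_def)
    show "((u, v) \<in> parcs D) \<noteq> ((v, u) \<in> parcs D)" if "(u, v) \<in> parcs G" for u v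
      using D that unfolding is_orientation_def by blast
  next
    assume "pverts D = pverts G" and sub: "parcs D \<subseteq> parcs G"
      and one: "\<forall>u v. (u, v) \<in> parcs G \<longrightarrow> ((u, v) \<in> parcs D) \<noteq> ((v, u) \<in> parcs D)"
    moreover have "parcs D \<union> (parcs D)\<inverse> = parcs G"
      using sub one sym by fast
    moreover have "parcs D \<inter> (parcs D)\<inverse> = {}"
      using sub one by fast
    ultimately show "is_orientation D G"
      by (simp add: is_orientation_def)
  qed
qed

lemma (in fin_digraph) digraph_dist_eq_mu:
  "ereal_of_enat (digraph_dist G u v) = \<mu> (\<lambda>_. 1) u v"
proof (rule antisym)
  have cost: "awalk_cost (\<lambda>_. 1) p = real (length p)" for p :: "'b list"
    by (induction p) auto
  show "ereal_of_enat (digraph_dist G u v) \<le> \<mu> (\<lambda>_. 1) u v"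
    unfolding \<mu>_def
  proof (rule INF_greatest)
    fix p assume "p \<in> {p. awalk u p v}"
    then have w: "awalk u p v" by simp
    have "length (awalk_to_apath p) \<le> length p"
      using w
    proof (induction rule: awalk_to_apath_induct)
      case (path p)
      then have "awalk_to_apath p = p"
        by (auto simp: awalk_to_apath.simps)
      then show ?case by simp
    next
      case (decomp p q r s)
      then have "p = q @ r @ s"
        by (auto elim: awalk_cyc_decompE)
      then show ?case
        using decomp step_awalk_to_apath[of u p v q r s] by simp
    qed
    moreover have "apath u (awalk_to_apath p) v"
      using w by (rule apath_awalk_to_apath)
    then have "digraph_dist G u v \<le> enat (length (awalk_to_apath p))"
      unfolding digraph_dist_def by (intro INF_lower) simp
    ultimately have "digraph_dist G u v \<le> enat (length p)"
      by (meson enat_ord_simps(1) order_trans)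
    then have "ereal_of_enat (digraph_dist G u v) \<le> ereal_of_enat (enat (length p))"
      by (simp only: ereal_of_enat_le_iff)
    then show "ereal_of_enat (digraph_dist G u v) \<le> ereal (awalk_cost (\<lambda>_. 1) p)"
      by (simp add: cost)
  qed
  show "\<mu> (\<lambda>_. 1) u v \<le> ereal_of_enat (digraph_dist G u v)"
  proof (cases "\<exists>p. apath u p v")
    case True
    then have "(\<lambda>p. enat (length p)) ` {p. apath u p v} \<noteq> {}" by simp
    then have "digraph_dist G u v \<in> (\<lambda>p. enat (length p)) ` {p. apath u p v}"
      unfolding digraph_dist_def by (metis (no_types, lifting) Inf_enat_def LeastI ex_in_conv)
    then obtain p where p: "apath u p v" "digraph_dist G u v = enat (length p)" by auto
    then have "\<mu> (\<lambda>_. 1) u v \<le> awalk_cost (\<lambda>_. 1) p"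
      by (intro min_cost_le_walk_cost) (rule awalkI_apath)
    then show ?thesis by (simp add: cost p)
  next
    case False
    then show ?thesis by (simp add: digraph_dist_def top_enat_def)
  qed
qed

end

theory Submission
  imports Defs
begin

text \<open>
  Work with the complement: a graph \<open>E\<close> on \<open>n\<close> vertices with at most \<open>n - 5\<close> edges, which may be
  enlarged to exactly \<open>n - 5\<close>. Induct on \<open>n\<close> by removing three vertices \<open>c\<close>, \<open>x\<close>, \<open>y\<close> at pairwise
  distance at least 3 in \<open>E\<close> that carry at least three edges of \<open>E\<close>. The remaining vertices \<open>V'\<close> have
  an orientation by induction, and it is extended by \<open>x \<rightarrow> V' \<rightarrow> y \<rightarrow> x\<close>, \<open>y \<rightarrow> c \<rightarrow> x\<close>, where \<open>c\<close> takes
  over the role of \<open>x\<close> (of \<open>y\<close>) at the vertices that are not joined to \<open>x\<close> (to \<open>y\<close>).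

  At least five components of \<open>E\<close> are trees, and each contains a vertex of degree at most 1 in \<open>E\<close>.
  So a suitable triple exists whenever \<open>E\<close> has a vertex of degree 3, and if the maximum degree is at
  most 2, the triple exists unless \<open>n \<le> 7\<close> or \<open>E\<close> consists of isolated vertices and one path or
  cycle on at most five vertices. For these small graphs an orientation is given explicitly.
\<close>

section \<open>Non-edges, neighbourhoods and degrees\<close>

definition pairs :: "'a set \<Rightarrow> 'a set set" where
  "pairs V = {e. e \<subseteq> V \<and> card e = 2}"

definition nb :: "'a set set \<Rightarrow> 'a \<Rightarrow> 'a set" where
  "nb E v = {u. {u, v} \<in> E}"

text \<open>\<open>E\<close> is the set of non-edges; pairs joined by neither \<open>E\<close> nor \<open>D\<close> may be oriented arbitrarily.\<close>

definition good :: "'a set \<Rightarrow> 'a set set \<Rightarrow> bool" where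
  "good V E \<longleftrightarrow> (\<exists>D. D \<subseteq> V \<times> V \<and> D \<inter> D\<inverse> = {} \<and> (\<forall>(u, v)\<in>D. {u, v} \<notin> E) \<and>
     (\<forall>u\<in>V. \<forall>v\<in>V. u \<noteq> v \<longrightarrow> (u, v) \<in> D \<union> D O D))"

lemma good_antimono: "good V E' \<Longrightarrow> E \<subseteq> E' \<Longrightarrow> good V E"
  unfolding good_def by (fast dest: subsetD)

lemma doubleton_in_pairs: "{u, v} \<in> pairs V \<longleftrightarrow> u \<in> V \<and> v \<in> V \<and> u \<noteq> v"
  by (auto simp: pairs_def card_2_iff doubleton_eq_iff)

lemma pairsE:
  assumes "e \<in> pairs V"
  obtains u v where "e = {u, v}" "u \<in> V" "v \<in> V" "u \<noteq> v"
  using assms by (auto simp: pairs_def card_2_iff)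

lemma finite_pairs: "finite V \<Longrightarrow> finite (pairs V)"
  by (rule finite_subset[of _ "Pow V"]) (auto simp: pairs_def)

lemma card_pairs: "finite V \<Longrightarrow> card (pairs V) = card V choose 2"
  unfolding pairs_def by (rule n_subsets)

lemma nb_sym: "u \<in> nb E v \<longleftrightarrow> v \<in> nb E u"
  by (simp add: nb_def insert_commute)

lemma nb_subset: "E \<subseteq> pairs V \<Longrightarrow> nb E v \<subseteq> V - {v}"
  unfolding nb_def using doubleton_in_pairs[of _ v V] by blast

lemma card_nb:
  assumes "E \<subseteq> pairs V"
  shows "card (nb E v) = card {e \<in> E. v \<in> e}"
proof -
  have "bij_betw (\<lambda>u. {u, v}) (nb E v) {e \<in> E. v \<in> e}"
  proof (rule bij_betwI')
    fix e assume "e \<in> {e \<in> E. v \<in> e}"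
    then have e: "e \<in> E" "v \<in> e" by auto
    then have "e \<in> pairs V" using assms by auto
    then obtain a b where "e = {a, b}" by (auto elim: pairsE)
    with e show "\<exists>u\<in>nb E v. e = {u, v}"
      by (auto simp: nb_def insert_commute)
  qed (auto simp: nb_def doubleton_eq_iff)
  then show ?thesis by (rule bij_betw_same_card)
qed

text \<open>Handshake lemma: every pair in \<open>E\<close> is counted once at each of its two
  endpoints.\<close>

lemma sum_card_nb:
  assumes "finite V" "E \<subseteq> pairs V"
  shows "(\<Sum>v\<in>V. card (nb E v)) = 2 * card E"
proof -
  have "card {v \<in> V. v \<in> e} = 2" if "e \<in> E" for e
  proof -
    have "e \<subseteq> V" "card e = 2" using that assms(2) by (auto simp: pairs_def)
    moreover from this have "{v \<in> V. v \<in> e} = e" by auto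
    ultimately show ?thesis by simp
  qed
  then have "(\<Sum>v\<in>V. card {e \<in> E. v \<in> e}) = 2 * card E"
    using assms finite_subset[OF assms(2) finite_pairs] by (intro sum_multicount) auto
  then show ?thesis by (simp add: card_nb[OF assms(2)])
qed

section \<open>Low-degree vertices in distinct components\<close>

text \<open>
  The colouring \<open>f\<close> is constant on connected components, so the vertices in \<open>S\<close> lie in pairwise
  different components.
\<close>

lemma forest_roots:
  assumes "finite V" "E \<subseteq> pairs V" "card E + k \<le> card V"
  shows "\<exists>S (f :: 'a \<Rightarrow> nat). S \<subseteq> V \<and> card S = k \<and> inj_on f S \<and>
    (\<forall>v\<in>S. card (nb E v) \<le> 1) \<and> (\<forall>u v. {u, v} \<in> E \<longrightarrow> f u = f v)"
  using assms
proof (induction "card V" arbitrary: V E k)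
  case 0
  then show ?case by (intro exI[of _ "{}"] exI[of _ "\<lambda>_. 0"]) auto
next
  case (Suc n)
  note fin = \<open>finite V\<close> and E = \<open>E \<subseteq> pairs V\<close>
  have finE: "finite E" using finite_subset[OF E finite_pairs[OF fin]] .
  show ?case
  proof (cases k)
    case 0
    then show ?thesis by (intro exI[of _ "{}"] exI[of _ "\<lambda>_. 0"]) auto
  next
    case (Suc j)
    \<comment> \<open>If all degrees were at least 2, the handshake sum would make
      \<open>card E\<close> at least \<open>card V\<close>, whereas \<open>k\<close> is positive
      here.\<close>
    have "\<exists>v\<in>V. card (nb E v) \<le> 1"
    proof (rule ccontr)
      assume "\<not> ?thesis"
      then have "(\<Sum>v\<in>V. 2) \<le> (\<Sum>v\<in>V. card (nb E v))"
        by (intro sum_mono) auto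
      then show False
        using Suc.prems(3) Suc sum_card_nb[OF fin E] by simp
    qed
    then obtain v where v: "v \<in> V" "card (nb E v) \<le> 1" by auto
    have finnb: "finite (nb E v)"
      using nb_subset[OF E] fin by (meson finite_Diff finite_subset)
    have cV: "n = card (V - {v})"
      using v fin Suc.hyps(2) by simp
    show ?thesis
    proof (cases "nb E v = {}")
      \<comment> \<open>An isolated \<open>v\<close> is a component of its own: it joins
        \<open>S\<close> with a colour new to \<open>S\<close>, and its removal uses up one of the
        \<open>k\<close> components.\<close>
      case True
      have E': "E \<subseteq> pairs (V - {v})"
      proof
        fix e assume e: "e \<in> E"
        then obtain a b where "e = {a, b}" "a \<in> V" "b \<in> V" "a \<noteq> b"
          using E by (blast elim: pairsE)
        moreover from this have "a \<noteq> v" "b \<noteq> v"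
          using True e by (auto simp: nb_def insert_commute)
        ultimately show "e \<in> pairs (V - {v})" by (simp add: doubleton_in_pairs)
      qed
      obtain S f where S: "S \<subseteq> V - {v}" "card S = j" "inj_on f S"
        "\<forall>w\<in>S. card (nb E w) \<le> 1" "\<forall>u w. {u, w} \<in> E \<longrightarrow> f u = (f w :: nat)"
        using Suc.hyps(1)[OF cV _ E', of j] fin Suc.prems(3) \<open>k = Suc j\<close> cV Suc.hyps(2) by auto
      have finS: "finite S" using S(1) fin by (meson finite_Diff finite_subset)
      then obtain z where z: "z \<notin> f ` S"
        using ex_new_if_finite[of "f ` S"] by auto
      have no: "{a, b} \<in> E \<Longrightarrow> a \<noteq> v \<and> b \<noteq> v" for a b
        using True by (auto simp: nb_def insert_commute)
      have "insert v S \<subseteq> V \<and> card (insert v S) = k \<and> inj_on (f(v := z)) (insert v S) \<and>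
        (\<forall>w\<in>insert v S. card (nb E w) \<le> 1) \<and>
        (\<forall>a b. {a, b} \<in> E \<longrightarrow> (f(v := z)) a = (f(v := z)) b)"
      proof (intro conjI)
        show "card (insert v S) = k"
          using S(1,2) finS \<open>k = Suc j\<close> by (subst card_insert_disjoint) auto
        show "inj_on (f(v := z)) (insert v S)"
          using S(1,3) z by (auto simp: inj_on_def)
        show "\<forall>a b. {a, b} \<in> E \<longrightarrow> (f(v := z)) a = (f(v := z)) b"
          using S(5) no by simp
      qed (use S v in auto)
      then show ?thesis by blast
    next
      case False
      then obtain u where u: "nb E v = {u}"
        using v(2) finnb by (metis One_nat_def card_1_singletonE card_0_eq le_Suc_eq le_zero_eq)
      \<comment> \<open>Deleting the leaf \<open>v\<close> with its edge lowers
        \<open>card E\<close> and \<open>card V\<close> by one each, so \<open>k\<close> stays the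
        same; \<open>v\<close> later receives the colour of \<open>u\<close>.\<close>
      let ?E = "E - {{u, v}}"
      have uv: "{u, v} \<in> E" using u by (auto simp: nb_def)
      then have "{u, v} \<in> pairs V" using E by blast
      then have "u \<in> V" "u \<noteq> v" by (simp_all add: doubleton_in_pairs)
      have nbv: "{w, v} \<in> E \<longleftrightarrow> w = u" for w
        using u unfolding nb_def by blast
      have other: "a \<noteq> v \<and> b \<noteq> v" if "{a, b} \<in> ?E" for a b
        using that nbv[of a] nbv[of b] by (auto simp: insert_commute)
      have E': "?E \<subseteq> pairs (V - {v})"
      proof
        fix e assume e: "e \<in> ?E"
        then obtain a b where "e = {a, b}" "a \<in> V" "b \<in> V" "a \<noteq> b"
          using E by (blast elim: pairsE)
        with other[of a b] e show "e \<in> pairs (V - {v})" by (simp add: doubleton_in_pairs)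
      qed
      have "card E > 0" using uv finE by (auto simp: card_gt_0_iff)
      then have "card ?E + k \<le> card (V - {v})"
        using Suc.prems(3) uv finE cV Suc.hyps(2) by (simp add: card_Diff_singleton)
      then obtain S f where S: "S \<subseteq> V - {v}" "card S = k" "inj_on f S"
        "\<forall>w\<in>S. card (nb ?E w) \<le> 1" "\<forall>a b. {a, b} \<in> ?E \<longrightarrow> f a = (f b :: nat)"
        using Suc.hyps(1)[OF cV _ E', of k] fin by auto
      have finS: "finite S" using S(1) fin by (meson finite_Diff finite_subset)
      let ?f = "f(v := f u)"
      \<comment> \<open>The edge to \<open>v\<close> may raise the degree of \<open>u\<close> to 2,
        so \<open>u\<close> is exchanged for the leaf \<open>v\<close>, which has the same
        colour.\<close>
      let ?S = "if u \<in> S then insert v (S - {u}) else S"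
      have nbw: "nb E w = nb ?E w" if "w \<noteq> u" "w \<noteq> v" for w
        using that by (auto simp: nb_def doubleton_eq_iff)
      have "?S \<subseteq> V \<and> card ?S = k \<and> inj_on ?f ?S \<and>
        (\<forall>w\<in>?S. card (nb E w) \<le> 1) \<and> (\<forall>a b. {a, b} \<in> E \<longrightarrow> ?f a = ?f b)"
      proof (intro conjI)
        show "?S \<subseteq> V" using S(1) v by auto
        show "card ?S = k"
        proof (cases "u \<in> S")
          case True
          then have "card S > 0" using finS by (auto simp: card_gt_0_iff)
          moreover have "v \<notin> S" using S(1) by auto
          ultimately show ?thesis using True finS S(2) by (simp add: card_Diff_singleton)
        qed (use S in simp)
        show "inj_on ?f ?S"
          using S(1,3) by (auto simp: inj_on_def)
        show "\<forall>w\<in>?S. card (nb E w) \<le> 1"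
        proof
          fix w assume w: "w \<in> ?S"
          show "card (nb E w) \<le> 1"
          proof (cases "w = v")
            case False
            then have "w \<in> S" "w \<noteq> u" using w by (auto split: if_splits)
            then show ?thesis using S(4) nbw False by auto
          qed (use v in simp)
        qed
        show "\<forall>a b. {a, b} \<in> E \<longrightarrow> ?f a = ?f b"
        proof (intro allI impI)
          fix a b assume ab: "{a, b} \<in> E"
          show "?f a = ?f b"
          proof (cases "{a, b} = {u, v}")
            case True
            then show ?thesis by (auto simp: doubleton_eq_iff)
          next
            case False
            then have "{a, b} \<in> ?E" using ab by simp
            then show ?thesis using S(5) other[of a b] by simp
          qed
        qed
      qed
      then show ?thesis by blast
    qed
  qed
qed

section \<open>Extending an orientation by three vertices\<close>

text \<open>The vertex \<open>c\<close> repairs what the non-edges spoil: it sends arcs to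
  \<open>nb E x\<close> and receives arcs from \<open>nb E y\<close>. Hence \<open>c\<close> and
  \<open>y\<close> reach \<open>V'\<close> directly or through \<open>x\<close> or \<open>c\<close>,
  and \<open>V'\<close> reaches \<open>c\<close> and \<open>x\<close> directly or through
  \<open>y\<close> or \<open>c\<close>. Only the way from \<open>x\<close> to \<open>nb E x\<close>
  and the way from \<open>nb E y\<close> to \<open>y\<close> need an arc inside \<open>V'\<close>;
  \<open>into\<close> and \<open>outof\<close> supply it. The vertices \<open>g\<close> and
  \<open>h\<close> serve the pairs among \<open>c\<close>, \<open>x\<close>,
  \<open>y\<close>.\<close>

lemma good_extend:
  assumes V: "V = V' \<union> {c, x, y}" "c \<notin> V'" "x \<notin> V'" "y \<notin> V'" "c \<noteq> x" "c \<noteq> y" "x \<noteq> y"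
    and E: "E \<subseteq> pairs V" "{c, x} \<notin> E" "{c, y} \<notin> E" "{x, y} \<notin> E"
    and disj: "nb E c \<inter> nb E x = {}" "nb E c \<inter> nb E y = {}" "nb E x \<inter> nb E y = {}"
    and D: "D \<subseteq> V' \<times> V'" "D \<inter> D\<inverse> = {}" "\<forall>(u, v)\<in>D. {u, v} \<notin> E"
      "\<forall>u\<in>V'. \<forall>v\<in>V'. u \<noteq> v \<longrightarrow> (u, v) \<in> D \<union> D O D"
    and into: "\<forall>v\<in>nb E x. \<exists>w\<in>V' - nb E x. (w, v) \<in> D"
    and outof: "\<forall>v\<in>nb E y. \<exists>w\<in>V' - nb E y. (v, w) \<in> D"
    and g: "g \<in> V' - (nb E c \<union> nb E x \<union> nb E y)" "h \<in> V' - (nb E c \<union> nb E x \<union> nb E y)" "g \<noteq> h"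
  shows "good V E"
proof -
  let ?X = "nb E x" and ?Y = "nb E y"
  define D' where "D' = D \<union> {(c, x), (y, c), (y, x), (c, g), (h, c)} \<union> {x} \<times> (V' - ?X) \<union>
    (V' - ?Y) \<times> {y} \<union> {c} \<times> ?X \<union> ?Y \<times> {c}"
  have XV: "v \<in> V'" if "v \<in> ?X" for v
    using subsetD[OF nb_subset[OF E(1)] that] that V(1) E(2,4) by (auto simp: nb_def insert_commute)
  have YV: "v \<in> V'" if "v \<in> ?Y" for v
    using subsetD[OF nb_subset[OF E(1)] that] that V(1) E(3,4) by (auto simp: nb_def insert_commute)
  have DV: "(u, v) \<in> D \<Longrightarrow> u \<in> V' \<and> v \<in> V'" for u v using D(1) by auto
  have asym: "(u, v) \<in> D \<Longrightarrow> (v, u) \<notin> D" for u v using D(2) by auto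
  have gV: "g \<in> V'" "h \<in> V'" and gX: "g \<notin> ?X" "h \<notin> ?X" and gY: "g \<notin> ?Y" "h \<notin> ?Y"
    and gL: "g \<notin> nb E c" "h \<notin> nb E c"
    using g by auto
  have XY: "v \<in> ?X \<Longrightarrow> v \<notin> ?Y" and XL: "v \<in> ?X \<Longrightarrow> v \<notin> nb E c" and YL: "v \<in> ?Y \<Longrightarrow> v \<notin> nb E c"
    for v using disj by auto
  have mem: "(u, v) \<in> D' \<longleftrightarrow> (u, v) \<in> D \<or> (u = c \<and> (v = x \<or> v = g \<or> v \<in> ?X)) \<or>
      (u = y \<and> (v = c \<or> v = x)) \<or> (u = x \<and> v \<in> V' \<and> v \<notin> ?X) \<or>
      (v = c \<and> (u = h \<or> u \<in> ?Y)) \<or> (v = y \<and> u \<in> V' \<and> u \<notin> ?Y)" for u v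
    unfolding D'_def by blast
  have 1: "D' \<subseteq> V \<times> V"
  proof (rule subrelI)
    fix u v assume "(u, v) \<in> D'"
    then show "(u, v) \<in> V \<times> V"
      unfolding mem V(1) using DV XV YV gV by blast
  qed
  \<comment> \<open>Among the new vertices only \<open>c\<close> has arcs both to and from
    \<open>V'\<close>. There, opposite arcs are excluded because \<open>g\<close> and
    \<open>h\<close> differ and avoid both neighbourhoods, and \<open>nb E x\<close> and
    \<open>nb E y\<close> are disjoint.\<close>
  have 2: "(v, u) \<notin> D'" if "(u, v) \<in> D'" for u v
    using that V(2-7) DV asym XV YV XY gV gX gY \<open>g \<noteq> h\<close> unfolding mem by metis
  have xcy: "x \<notin> nb E c" "c \<notin> nb E y" "x \<notin> nb E y"
    using E(2-4) by (simp_all add: nb_def insert_commute)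
  have rev: "c \<notin> nb E h" "u \<in> ?Y \<Longrightarrow> c \<notin> nb E u" "u \<notin> ?Y \<Longrightarrow> y \<notin> nb E u" for u
    using gL(2) YL[of u] nb_sym[of c E h] nb_sym[of c E u] nb_sym[of y E u] by blast+
  have 3: "{u, v} \<notin> E" if "(u, v) \<in> D'" for u v
  proof -
    have "v \<notin> nb E u"
      using that[unfolded mem]
    proof (elim disjE conjE)
      assume "(u, v) \<in> D"
      then show ?thesis using D(3) by (auto simp: nb_def insert_commute)
    qed (use xcy gL XL rev in simp_all)
    then show ?thesis by (simp add: nb_def insert_commute)
  qed
  have old: "(u, v) \<in> D' \<union> D' O D'" if "u \<in> V'" "v \<in> V'" "u \<noteq> v" for u v
    using bspec[OF bspec[OF D(4) that(1)] that(2)] that(3) mem by blast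
  have cx: "(c, x) \<in> D'" and yc: "(y, c) \<in> D'" and yx: "(y, x) \<in> D'"
    and xV: "v \<in> V' \<Longrightarrow> v \<notin> ?X \<Longrightarrow> (x, v) \<in> D'" and Vy: "v \<in> V' \<Longrightarrow> v \<notin> ?Y \<Longrightarrow> (v, y) \<in> D'"
    and cX: "v \<in> ?X \<Longrightarrow> (c, v) \<in> D'" and Yc: "v \<in> ?Y \<Longrightarrow> (v, c) \<in> D'"
    and cg: "(c, g) \<in> D'" and hc: "(h, c) \<in> D'" for v
    unfolding mem by simp_all
  have fwd: "(c, v) \<in> D' \<union> D' O D'" "(x, v) \<in> D' \<union> D' O D'" "(y, v) \<in> D' \<union> D' O D'"
    if "v \<in> V'" for v
  proof -
    show "(c, v) \<in> D' \<union> D' O D'"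
      using cX cx xV[OF that] by blast
    show "(y, v) \<in> D' \<union> D' O D'"
      using yc cX yx xV[OF that] by blast
    show "(x, v) \<in> D' \<union> D' O D'"
    proof (cases "v \<in> ?X")
      case True
      then obtain w where "w \<in> V'" "w \<notin> ?X" "(w, v) \<in> D" using into by auto
      then have "(x, w) \<in> D'" "(w, v) \<in> D'" using xV mem by simp_all
      then show ?thesis by blast
    qed (use xV that in simp)
  qed
  have bwd: "(v, c) \<in> D' \<union> D' O D'" "(v, x) \<in> D' \<union> D' O D'" "(v, y) \<in> D' \<union> D' O D'"
    if "v \<in> V'" for v
  proof -
    show "(v, c) \<in> D' \<union> D' O D'"
      using Yc yc Vy[OF that] by blast
    show "(v, x) \<in> D' \<union> D' O D'"
      using yx Yc cx Vy[OF that] by blast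
    show "(v, y) \<in> D' \<union> D' O D'"
    proof (cases "v \<in> ?Y")
      case True
      then obtain w where "w \<in> V'" "w \<notin> ?Y" "(v, w) \<in> D" using outof by auto
      then have "(w, y) \<in> D'" "(v, w) \<in> D'" using Vy mem by simp_all
      then show ?thesis by blast
    qed (use Vy that in simp)
  qed
  \<comment> \<open>The routes are \<open>x -> h -> c\<close>, \<open>c -> g -> y\<close> and
    \<open>x -> g -> y\<close>.\<close>
  have "(x, c) \<in> D' O D'" "(c, y) \<in> D' O D'" "(x, y) \<in> D' O D'"
    using relcompI[OF xV hc] relcompI[OF cg Vy] relcompI[OF xV Vy, of g] gV gX gY by auto
  define R where "R = D' \<union> D' O D'"
  have "(x, c) \<in> R" "(c, y) \<in> R" "(x, y) \<in> R" "(c, x) \<in> R" "(y, c) \<in> R" "(y, x) \<in> R"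
    using \<open>(x, c) \<in> D' O D'\<close> \<open>(c, y) \<in> D' O D'\<close> \<open>(x, y) \<in> D' O D'\<close> cx yc yx by (simp_all add: R_def)
  with old[folded R_def] fwd[folded R_def] bwd[folded R_def]
  have "(u, v) \<in> R" if "u \<in> V" "v \<in> V" "u \<noteq> v" for u v
    using that unfolding V(1) by (elim UnE insertE emptyE) simp_all
  then have 4: "(u, v) \<in> D' \<union> D' O D'" if "u \<in> V" "v \<in> V" "u \<noteq> v" for u v
    using that by (simp add: R_def)
  show ?thesis
    unfolding good_def using 1 2 3 4 by (intro exI[of _ D'] conjI) (simp, blast, blast, blast)
qed

subsection \<open>Explicit orientations of small graphs\<close>

text \<open>An executable form of \<open>good\<close> on the vertices \<open>0..<n\<close>: all
  quantifiers range over lists, so evaluation decides it. \<open>H\<close> may list a forbidden pair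
  in either order and may contain loops.\<close>

definition witness :: "nat \<Rightarrow> (nat \<times> nat) list \<Rightarrow> (nat \<times> nat) list \<Rightarrow> bool" where
  "witness n H D \<longleftrightarrow>
    (\<forall>(i, j) \<in> set D. i < n \<and> j < n \<and> (j, i) \<notin> set D \<and> (i, j) \<notin> set H \<and> (j, i) \<notin> set H) \<and>
    (\<forall>(i, j) \<in> set H. i < n \<and> j < n) \<and>
    (\<forall>i \<in> set [0..<n]. \<forall>j \<in> set [0..<n]. i = j \<or> (i, j) \<in> set D \<or>
      (\<exists>k \<in> set [0..<n]. (i, k) \<in> set D \<and> (k, j) \<in> set D))"

lemma good_witness:
  assumes w: "witness (length vs) H D" and vs: "distinct vs" "set vs = V"
    and E: "E \<subseteq> (\<lambda>(i, j). {vs ! i, vs ! j}) ` set H"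
  shows "good V E"
proof -
  let ?n = "length vs"
  define D' where "D' = (\<lambda>(i, j). (vs ! i, vs ! j)) ` set D"
  have inj: "vs ! i = vs ! j \<longleftrightarrow> i = j" if "i < ?n" "j < ?n" for i j
    using that vs(1) by (simp add: nth_eq_iff_index_eq)
  have bd: "i < ?n \<and> j < ?n \<and> (j, i) \<notin> set D \<and> (i, j) \<notin> set H \<and> (j, i) \<notin> set H"
    if "(i, j) \<in> set D" for i j
    using w that unfolding witness_def by fast
  have bH: "i < ?n \<and> j < ?n" if "(i, j) \<in> set H" for i j
    using w that unfolding witness_def by fast
  have "D' \<subseteq> V \<times> V"
    using bd vs(2) unfolding D'_def by auto
  moreover have "D' \<inter> D'\<inverse> = {}"
  proof (rule ccontr)
    assume "\<not> ?thesis"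
    then obtain i j k l where "(i, j) \<in> set D" "(k, l) \<in> set D" "vs ! i = vs ! l" "vs ! j = vs ! k"
      unfolding D'_def by auto
    then show False using bd inj by metis
  qed
  moreover have "\<forall>(u, v)\<in>D'. {u, v} \<notin> E"
  proof (clarify)
    fix u v assume "(u, v) \<in> D'" "{u, v} \<in> E"
    then obtain i j k l where "(i, j) \<in> set D" "(k, l) \<in> set H" "{vs ! i, vs ! j} = {vs ! k, vs ! l}"
      using E unfolding D'_def by fastforce
    then show False using bd bH inj unfolding doubleton_eq_iff by metis
  qed
  moreover have "\<forall>u\<in>V. \<forall>v\<in>V. u \<noteq> v \<longrightarrow> (u, v) \<in> D' \<union> D' O D'"
  proof (intro ballI impI)
    fix u v assume "u \<in> V" "v \<in> V" "u \<noteq> v"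
    then obtain i j where ij: "i < ?n" "j < ?n" "u = vs ! i" "v = vs ! j" "i \<noteq> j"
      using vs(2) by (metis in_set_conv_nth)
    then have "(i, j) \<in> set D \<or> (\<exists>k. (i, k) \<in> set D \<and> (k, j) \<in> set D)"
      using w unfolding witness_def set_upt atLeastLessThan_iff Ball_def Bex_def by blast
    then show "(u, v) \<in> D' \<union> D' O D'"
      unfolding D'_def ij by force
  qed
  ultimately show ?thesis unfolding good_def by blast
qed

text \<open>Only the endpoints of non-edges have to be named; the other vertices follow in any order
  and leave the indices below \<open>length us\<close> unchanged.\<close>

lemma good_witness_prefix:
  assumes V: "finite V" "set us \<subseteq> V" "distinct us"
    and w: "witness (card V) H D" and H: "\<forall>(i, j)\<in>set H. i < length us \<and> j < length us"
    and E: "E \<subseteq> (\<lambda>(i, j). {us ! i, us ! j}) ` set H"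
  shows "good V E"
proof -
  obtain rs where rs: "set rs = V - set us" "distinct rs"
    using V(1) finite_distinct_list[of "V - set us"] by auto
  have "distinct (us @ rs)" "set (us @ rs) = V" using rs V by auto
  moreover from this have "length (us @ rs) = card V" by (metis distinct_card)
  moreover have "(\<lambda>(i, j). {us ! i, us ! j}) ` set H = (\<lambda>(i, j). {(us @ rs) ! i, (us @ rs) ! j}) ` set H"
    using H by (intro image_cong) (auto simp: nth_append)
  ultimately show ?thesis using good_witness[of "us @ rs" H D V E] w E by simp
qed

text \<open>At least \<open>k\<close> vertices lie on no edge of \<open>E\<close>. Listing
  \<open>k\<close> of them first leaves both ends of every edge at indices from \<open>k\<close> on,
  whatever the shape of \<open>E\<close>.\<close>

lemma isolated_enumeration:
  assumes V: "finite V" "E \<subseteq> pairs V" "card (\<Union>E) + k \<le> card V"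
  obtains vs where "distinct vs" "set vs = V"
    "E \<subseteq> (\<lambda>(i, j). {vs ! i, vs ! j}) ` set (List.product [k..<card V] [k..<card V])"
proof -
  have sub: "\<Union>E \<subseteq> V" using V(2) by (auto simp: pairs_def)
  then have "card (V - \<Union>E) \<ge> k"
    using V(1,3) by (simp add: card_Diff_subset finite_subset)
  then obtain I where I: "I \<subseteq> V - \<Union>E" "card I = k"
    by (meson obtain_subset_with_card_n)
  have "finite I" using I(1) V(1) by (meson finite_Diff finite_subset)
  then obtain xs where xs: "set xs = I" "distinct xs" using finite_distinct_list by auto
  obtain ys where ys: "set ys = V - I" "distinct ys"
    using V(1) finite_distinct_list[of "V - I"] by auto
  have len: "length xs = k" "length (xs @ ys) = card V"
  proof -
    have "set (xs @ ys) = V" "distinct (xs @ ys)" using xs ys I(1) by auto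
    then show "length (xs @ ys) = card V" using distinct_card by metis
    show "length xs = k" using xs I(2) distinct_card by metis
  qed
  have idx: "\<exists>i. i \<in> set [k..<card V] \<and> v = (xs @ ys) ! i" if "v \<in> \<Union>E" for v
  proof -
    have "v \<in> set ys" using that I(1) sub ys(1) by auto
    then obtain i where "i < length ys" "v = ys ! i" by (auto simp: in_set_conv_nth)
    then show ?thesis using len by (intro exI[of _ "k + i"]) (auto simp: nth_append)
  qed
  show ?thesis
  proof
    show "distinct (xs @ ys)" "set (xs @ ys) = V" using xs ys I(1) by auto
    show "E \<subseteq> (\<lambda>(i, j). {(xs @ ys) ! i, (xs @ ys) ! j}) ` set (List.product [k..<card V] [k..<card V])"
    proof
      fix e assume e: "e \<in> E"
      then obtain a b where ab: "e = {a, b}" using V(2) by (blast elim: pairsE)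
      then have "a \<in> \<Union>E" "b \<in> \<Union>E" using e by auto
      then obtain i j where "i \<in> set [k..<card V]" "a = (xs @ ys) ! i"
        "j \<in> set [k..<card V]" "b = (xs @ ys) ! j"
        using idx by meson
      then show "e \<in> (\<lambda>(i, j). {(xs @ ys) ! i, (xs @ ys) ! j}) `
          set (List.product [k..<card V] [k..<card V])"
        using ab by (intro image_eqI[of _ _ "(i, j)"]) auto
    qed
  qed
qed

text \<open>A witness that treats all pairs of indices from \<open>k\<close> on as non-edges covers
  every \<open>E\<close> with at least \<open>k\<close> isolated vertices at once.\<close>

lemma good_if_isolated:
  assumes "finite V" "E \<subseteq> pairs V" "card (\<Union>E) + k \<le> card V"
    and "witness (card V) (List.product [k..<card V] [k..<card V]) D"
  shows "good V E"
proof -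
  obtain vs where vs: "distinct vs" "set vs = V"
    "E \<subseteq> (\<lambda>(i, j). {vs ! i, vs ! j}) ` set (List.product [k..<card V] [k..<card V])"
    using isolated_enumeration[OF assms(1-3)] by blast
  moreover have "length vs = card V" using vs distinct_card by fastforce
  ultimately show ?thesis using good_witness assms(4) by metis
qed

definition restrict_arcs :: "nat \<Rightarrow> (nat \<times> nat) list \<Rightarrow> (nat \<times> nat) list" where
  "restrict_arcs n D = filter (\<lambda>(i, j). i < n \<and> j < n) D"

text \<open>
  A tournament on the first \<open>k\<close> vertices (\<open>k = 4\<close>, \<open>5\<close>), together with pairwise non-adjacent further
  vertices whose out-neighbourhoods form an antichain of subsets of \<open>{0..<k}\<close>. Both were found by
  exhaustive search such that all the prefixes used below still have diameter two.
\<close>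

definition arcs4 :: "(nat \<times> nat) list" where
  "arcs4 = [(0,3), (1,0), (2,0), (2,1), (3,1), (3,2), (4,0), (1,4), (4,2), (3,4), (0,5), (5,1),
    (2,5), (5,3), (0,6), (1,6), (6,2), (6,3)]"

definition arcs5 :: "(nat \<times> nat) list" where
  "arcs5 = [(0,4), (1,0), (1,4), (2,0), (2,1), (3,0), (3,1), (3,2), (4,2), (4,3), (0,5), (5,1),
    (2,5), (5,3), (4,5), (6,0), (1,6), (2,6), (6,3), (4,6), (0,7), (7,1), (2,7), (3,7), (7,4),
    (0,8), (1,8), (8,2), (3,8), (8,4), (0,9), (1,9), (2,9), (9,3), (9,4)]"

text \<open>Each further vertex is joined to all of the first four. For two further vertices
  \<open>p\<close> and \<open>q\<close>, the antichain property gives an out-neighbour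
  \<open>w\<close> of \<open>p\<close> that is none of \<open>q\<close>, so
  \<open>p -> w -> q\<close>. Evaluation checks this and the remaining pairs.\<close>

lemma witness_arcs4:
  "\<forall>n \<in> set [5..<8]. witness n (List.product [4..<n] [4..<n]) (restrict_arcs n arcs4)"
  by code_simp

lemma witness_arcs5:
  "\<forall>n \<in> set [6..<11]. witness n (List.product [5..<n] [5..<n]) (restrict_arcs n arcs5)"
  by code_simp

lemma good_four_isolated:
  assumes "finite V" "E \<subseteq> pairs V" "card (\<Union>E) + 4 \<le> card V" "5 \<le> card V" "card V \<le> 7"
  shows "good V E"
proof (rule good_if_isolated[OF assms(1-3)])
  show "witness (card V) (List.product [4..<card V] [4..<card V]) (restrict_arcs (card V) arcs4)"
    by (rule bspec[OF witness_arcs4]) (use assms(4,5) in auto)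
qed

lemma good_five_isolated:
  assumes "finite V" "E \<subseteq> pairs V" "card (\<Union>E) + 5 \<le> card V" "6 \<le> card V" "card V \<le> 10"
  shows "good V E"
proof (rule good_if_isolated[OF assms(1-3)])
  show "witness (card V) (List.product [5..<card V] [5..<card V]) (restrict_arcs (card V) arcs5)"
    by (rule bspec[OF witness_arcs5]) (use assms(4,5) in auto)
qed

text \<open>Two disjoint edges on seven vertices leave only three isolated vertices, one too few for
  \<open>good_four_isolated\<close>.\<close>

lemma good_2K2:
  assumes "finite V" "card V = 7" "{a, b, c, d} \<subseteq> V" "distinct [a, b, c, d]"
    and "E \<subseteq> {{a, b}, {c, d}}"
  shows "good V E"
proof -
  have "witness 7 [(0,1), (2,3)] [(2,0), (3,0), (0,4), (0,5), (0,6), (2,1), (1,3), (4,1), (1,5),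
    (1,6), (4,2), (5,2), (2,6), (3,4), (3,5), (6,3), (4,5), (6,4), (5,6)]"
    by code_simp
  then show ?thesis
    using assms by (intro good_witness_prefix[of V "[a, b, c, d]" "[(0,1), (2,3)]"]) auto
qed

text \<open>A path has one vertex more than edges: with three edges on eight vertices it leaves four
  isolated vertices, one too few for \<open>good_five_isolated\<close>.\<close>

lemma good_P4:
  assumes "finite V" "card V = 8" "{a, b, c, d} \<subseteq> V" "distinct [a, b, c, d]"
    and "E \<subseteq> {{a, b}, {b, c}, {c, d}}"
  shows "good V E"
proof -
  have "witness 8 [(0,1), (1,2), (2,3)] [(2,0), (0,3), (0,4), (0,5), (6,0), (7,0), (1,3), (4,1),
    (5,1), (1,6), (1,7), (2,4), (5,2), (2,6), (7,2), (3,4), (3,5), (6,3), (3,7), (4,5), (6,4),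
    (4,7), (5,6), (7,5), (6,7)]"
    by code_simp
  then show ?thesis
    using assms by (intro good_witness_prefix[of V "[a, b, c, d]" "[(0,1), (1,2), (2,3)]"]) auto
qed

text \<open>The path with four edges on nine vertices again leaves only four isolated
  vertices.\<close>

lemma good_P5:
  assumes "finite V" "card V = 9" "{a, b, c, d, e} \<subseteq> V" "distinct [a, b, c, d, e]"
    and "E \<subseteq> {{a, b}, {b, c}, {c, d}, {d, e}}"
  shows "good V E"
proof -
  have "witness 9 [(0,1), (1,2), (2,3), (3,4)] [(2,0), (3,0), (0,4), (0,5), (6,0), (0,7), (8,0),
    (1,3), (4,1), (5,1), (1,6), (1,7), (8,1), (2,4), (5,2), (6,2), (2,7), (8,2), (3,5), (6,3),
    (7,3), (8,3), (5,4), (6,4), (4,7), (4,8), (5,6), (7,5), (5,8), (7,6), (6,8), (8,7)]"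
    by code_simp
  then show ?thesis
    using assms
    by (intro good_witness_prefix[of V "[a, b, c, d, e]" "[(0,1), (1,2), (2,3), (3,4)]"]) auto
qed

subsection \<open>The induction\<close>

text \<open>
  If \<open>x\<close> has two \<open>E\<close>-neighbours \<open>p\<close>, \<open>q\<close>, each of them needs an in-neighbour outside \<open>{p, q}\<close>. If this
  fails for the given orientation and for its reverse, then every other vertex \<open>w\<close> of \<open>V'\<close> satisfies
  \<open>p \<rightarrow> w \<rightarrow> q \<rightarrow> p\<close>, so that \<open>p\<close> and \<open>q\<close> have no \<open>E\<close>-neighbour besides \<open>x\<close>.
\<close>

lemma good_step:
  fixes V :: "'a set"
  assumes IH: "\<And>(V' :: 'a set) E'. finite V' \<Longrightarrow> card V' < card V \<Longrightarrow> E' \<subseteq> pairs V' \<Longrightarrow>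
      card E' + 5 \<le> card V' \<Longrightarrow> good V' E'"
    and V: "finite V" "E \<subseteq> pairs V" "card E + 5 \<le> card V"
    and cxy: "c \<in> V" "x \<in> V" "y \<in> V" "c \<noteq> x" "c \<noteq> y" "x \<noteq> y"
    and nadj: "{c, x} \<notin> E" "{c, y} \<notin> E" "{x, y} \<notin> E"
    and disj: "nb E c \<inter> nb E x = {}" "nb E c \<inter> nb E y = {}" "nb E x \<inter> nb E y = {}"
    and deg: "card (nb E c) + card (nb E x) + card (nb E y) \<ge> 3"
    and x: "card (nb E x) \<le> 1 \<or>
      card (nb E x) = 2 \<and> nb E y = {} \<and> (\<exists>a\<in>nb E x. card (nb E a) \<ge> 2)"
    and y: "card (nb E y) \<le> 1"
  shows "good V E"
proof -
  let ?X = "nb E x" and ?Y = "nb E y" and ?L = "nb E c"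
  define V' where "V' = V - {c, x, y}"
  define E' where "E' = {e \<in> E. e \<inter> {c, x, y} = {}}"
  have V'V: "V = V' \<union> {c, x, y}" "c \<notin> V'" "x \<notin> V'" "y \<notin> V'" using cxy by (auto simp: V'_def)
  have fin: "finite V'" "finite ?X" "finite ?Y" "finite ?L"
    using V(1) finite_subset[OF nb_subset[OF V(2)]] by (auto simp: V'_def)
  have finE: "finite E" using finite_subset[OF V(2) finite_pairs[OF V(1)]] .
  have cV': "card V' + 3 = card V"
    using V(1) cxy card_mono[OF V(1), of "{c, x, y}"] by (simp add: V'_def card_Diff_subset)
  let ?i = "\<lambda>v. {e \<in> E. v \<in> e}"
  \<comment> \<open>No edge contains two of \<open>c\<close>, \<open>x\<close>, \<open>y\<close>, so
    their degrees add up to a number of distinct edges. Removing the three vertices removes at least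
    three edges and preserves the bound for the induction hypothesis.\<close>
  have no2: "u \<notin> e \<or> v \<notin> e" if "e \<in> E" "u \<noteq> v" "{u, v} \<notin> E" for u v e
    using that V(2) by (auto simp: pairs_def card_2_iff insert_commute)
  have "card E \<ge> card (E' \<union> (?i c \<union> ?i x \<union> ?i y))"
    using finE by (intro card_mono) (auto simp: E'_def)
  moreover have "card (E' \<union> (?i c \<union> ?i x \<union> ?i y)) = card E' + card (?i c \<union> ?i x \<union> ?i y)"
    using finE by (intro card_Un_disjoint) (auto simp: E'_def)
  moreover have "card (?i c \<union> ?i x \<union> ?i y) = card (?i c \<union> ?i x) + card (?i y)"
    using finE no2 cxy nadj by (intro card_Un_disjoint) auto
  moreover have "card (?i c \<union> ?i x) = card (?i c) + card (?i x)"
    using finE no2 cxy nadj by (intro card_Un_disjoint) auto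
  ultimately have cE: "card E' + (card ?L + card ?X + card ?Y) \<le> card E"
    by (simp add: card_nb[OF V(2)])
  have E': "E' \<subseteq> pairs V'"
    using V(2) unfolding E'_def V'_def pairs_def by blast
  have "good V' E'"
    by (rule IH[OF fin(1) _ E']) (use cV' cE deg V(3) in linarith)+
  then obtain D where D: "D \<subseteq> V' \<times> V'" "D \<inter> D\<inverse> = {}" "\<forall>(u, v)\<in>D. {u, v} \<notin> E'"
      "\<forall>u\<in>V'. \<forall>v\<in>V'. u \<noteq> v \<longrightarrow> (u, v) \<in> D \<union> D O D"
    unfolding good_def by blast
  have DE: "\<forall>(u, v)\<in>D. {u, v} \<notin> E"
    using D(1,3) V'V unfolding E'_def by fast
  \<comment> \<open>\<open>V'\<close> has at least \<open>card E + 2\<close> vertices and the three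
    neighbourhoods together have at most \<open>card E\<close>, which leaves room for
    \<open>g\<close> and \<open>h\<close>.\<close>
  have "card (?L \<union> ?X \<union> ?Y) \<le> card ?L + card ?X + card ?Y"
    using card_Un_le[of "?L \<union> ?X" ?Y] card_Un_le[of ?L ?X] by linarith
  then have "card (V' - (?L \<union> ?X \<union> ?Y)) \<ge> 2"
    using diff_card_le_card_Diff[of "?L \<union> ?X \<union> ?Y" V'] fin cE cV' V(3) by simp
  then obtain G where "G \<subseteq> V' - (?L \<union> ?X \<union> ?Y)" "card G = 2"
    by (meson obtain_subset_with_card_n)
  then obtain g h where g: "g \<in> V' - (?L \<union> ?X \<union> ?Y)" "h \<in> V' - (?L \<union> ?X \<union> ?Y)" "g \<noteq> h"
    by (auto simp: card_2_iff)
  have DV: "u \<in> V' \<and> v \<in> V'" if "(u, v) \<in> D" for u v using D(1) that by auto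
  have asym: "(v, u) \<notin> D" if "(u, v) \<in> D" for u v using D(2) that by auto
  have two: "(u, v) \<in> D \<or> (\<exists>w. (u, w) \<in> D \<and> (w, v) \<in> D)" if "u \<in> V'" "v \<in> V'" "u \<noteq> v" for u v
    using D(4) that by blast
  have XV: "?X \<subseteq> V'" and YV: "?Y \<subseteq> V'"
    using nb_subset[OF V(2), of x] nb_subset[OF V(2), of y] nadj
    by (auto simp: V'_def nb_def insert_commute)
  \<comment> \<open>Reversing all arcs preserves the distance condition, so \<open>D\<close> and its
    converse are both candidates for the extension.\<close>
  have ext: "good V E" if "\<forall>v\<in>?X. \<exists>w\<in>V' - ?X. (w, v) \<in> D'" "\<forall>v\<in>?Y. \<exists>w\<in>V' - ?Y. (v, w) \<in> D'"
    "D' = D \<or> D' = D\<inverse>" for D'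
  proof (rule good_extend[OF V'V cxy(4-6) V(2) nadj disj _ _ _ _ that(1,2) g])
    show "D' \<subseteq> V' \<times> V'" "D' \<inter> D'\<inverse> = {}" "\<forall>(u, v)\<in>D'. {u, v} \<notin> E"
      using that(3) D(1,2) DE by (auto simp: insert_commute)
    show "\<forall>u\<in>V'. \<forall>v\<in>V'. u \<noteq> v \<longrightarrow> (u, v) \<in> D' \<union> D' O D'"
      using that(3) two by blast
  qed
  from x show ?thesis
  proof
    assume x1: "card ?X \<le> 1"
    have single: "z \<notin> nb E u" if "card (nb E u) \<le> 1" "v \<in> nb E u" "z \<noteq> v" "finite (nb E u)" for u v z
      using that card_le_Suc0_iff_eq[of "nb E u"] by auto
    show ?thesis
    proof (rule ext[of D])
      \<comment> \<open>Since \<open>g\<close> reaches \<open>v\<close>, some arc enters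
        \<open>v\<close>; its tail differs from \<open>v\<close>, the only element of
        \<open>?X\<close>.\<close>
      show "\<forall>v\<in>?X. \<exists>w\<in>V' - ?X. (w, v) \<in> D"
      proof
        fix v assume v: "v \<in> ?X"
        then have "(g, v) \<in> D \<or> (\<exists>w. (g, w) \<in> D \<and> (w, v) \<in> D)"
          using two[of g v] g XV by auto
        then obtain w where w: "(w, v) \<in> D" by auto
        then have "w \<noteq> v" using asym by auto
        then show "\<exists>w\<in>V' - ?X. (w, v) \<in> D"
          using w single[OF x1 v _ fin(2)] DV[OF w] by auto
      qed
      show "\<forall>v\<in>?Y. \<exists>w\<in>V' - ?Y. (v, w) \<in> D"
      proof
        fix v assume v: "v \<in> ?Y"
        then have "(v, g) \<in> D \<or> (\<exists>w. (v, w) \<in> D \<and> (w, g) \<in> D)"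
          using two[of v g] g YV by auto
        then obtain w where w: "(v, w) \<in> D" by auto
        then have "w \<noteq> v" using asym by auto
        then show "\<exists>w\<in>V' - ?Y. (v, w) \<in> D"
          using w single[OF y v _ fin(3)] DV[OF w] by auto
      qed
    qed simp
  next
    assume x2: "card ?X = 2 \<and> ?Y = {} \<and> (\<exists>a\<in>?X. card (nb E a) \<ge> 2)"
    show ?thesis
    proof (rule ccontr)
      assume ng: "\<not> good V E"
      \<comment> \<open>\<open>p\<close> obstructs the extension of \<open>D\<close>, and
        \<open>q\<close> that of its converse; the condition on \<open>?Y\<close> is
        vacuous.\<close>
      then obtain p where p: "p \<in> ?X" "\<forall>w\<in>V' - ?X. (w, p) \<notin> D"
        using ext[of D] x2 by auto
      obtain q where q: "q \<in> ?X" "\<forall>w\<in>V' - ?X. (q, w) \<notin> D"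
        using ng ext[of "D\<inverse>"] x2 by auto
      obtain s t where st: "?X = {s, t}" "s \<noteq> t" using x2 by (auto simp: card_2_iff)
      have gX: "g \<in> V' - ?X" using g by auto
      have pq: "?X = {p, q}" "p \<noteq> q"
      proof -
        \<comment> \<open>Otherwise \<open>p\<close> has an in-arc and an out-arc, as the ways from
          and to \<open>g\<close> show, and both join it to the other element of \<open>?X\<close>:
          a pair of opposite arcs.\<close>
        have "p \<noteq> q"
        proof
          assume eq: "p = q"
          obtain p' where p': "?X = {p, p'}" using st p(1) by auto
          have "(g, p) \<in> D \<or> (\<exists>w. (g, w) \<in> D \<and> (w, p) \<in> D)"
            using two[of g p] gX p(1) XV by auto
          then obtain w where "(w, p) \<in> D" by auto
          moreover from this have "w \<in> ?X" "w \<noteq> p"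
            using p(2) DV[of w p] asym[of w p] by blast+
          ultimately have "(p', p) \<in> D" unfolding p' by blast
          have "(p, g) \<in> D \<or> (\<exists>w. (p, w) \<in> D \<and> (w, g) \<in> D)"
            using two[of p g] gX p(1) XV by auto
          then obtain w' where "(p, w') \<in> D" by auto
          moreover from this have "w' \<in> ?X" "w' \<noteq> p"
            using q(2) DV[of p w'] asym[of p w'] unfolding eq by blast+
          ultimately have "(p, p') \<in> D" unfolding p' by blast
          with \<open>(p', p) \<in> D\<close> show False using asym by blast
        qed
        then show "?X = {p, q}" "p \<noteq> q" using st p(1) q(1) by auto
      qed
      have w: "(w, q) \<in> D \<and> (q, p) \<in> D \<and> (p, w) \<in> D" if "w \<in> V' - ?X" for w
      proof -
        have "(w, p) \<notin> D" "(q, w) \<notin> D" using p(2) q(2) that by auto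
        moreover have "w \<in> V'" "w \<noteq> p" "q \<noteq> w" "p \<in> V'" "q \<in> V'" using that pq XV by auto
        ultimately obtain z z' where "(w, z) \<in> D" "(z, p) \<in> D" "(q, z') \<in> D" "(z', w) \<in> D"
          using two[of w p] two[of q w] by blast
        moreover from this have "z \<in> ?X" "z \<noteq> p" "z' \<in> ?X" "z' \<noteq> q"
          using p(2) q(2) DV[of z p] DV[of q z'] asym[of z p] asym[of q z'] by blast+
        then have "z = q" "z' = p" unfolding pq(1) by blast+
        ultimately show ?thesis by simp
      qed
      \<comment> \<open>\<open>D\<close> joins \<open>r\<close> to every vertex of \<open>V'\<close>
        outside \<open>?X\<close> and to the other element of \<open>?X\<close>, while
        \<open>c\<close> and \<open>y\<close> share no neighbour with \<open>x\<close>. So only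
        \<open>x\<close> is left.\<close>
      have "nb E r \<subseteq> {x}" if r: "r \<in> ?X" for r
      proof
        fix z assume z: "z \<in> nb E r"
        then have zr: "{z, r} \<in> E" "r \<in> nb E z" by (simp_all add: nb_def insert_commute)
        have "z \<in> V" "z \<noteq> r" using z nb_subset[OF V(2)] by auto
        moreover have "z \<noteq> c" "z \<noteq> y" using zr(2) disj r x2 by auto
        moreover have "z \<notin> V' - ?X"
        proof
          assume "z \<in> V' - ?X"
          from w[OF this] r pq have "{z, r} \<notin> E" using DE by (auto simp: insert_commute)
          with zr show False by simp
        qed
        moreover have "z \<notin> ?X"
        proof
          assume "z \<in> ?X"
          then have "{z, r} = {q, p}" using r pq \<open>z \<noteq> r\<close> by auto
          moreover have "{q, p} \<notin> E" using w[OF gX] DE by auto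
          ultimately show False using zr by simp
        qed
        ultimately show "z \<in> {x}" using V'V by auto
      qed
      then have "card (nb E r) \<le> 1" if "r \<in> ?X" for r
        using that card_mono[of "{x}" "nb E r"] by simp
      then show False using x2 by fastforce
    qed
  qed
qed

section \<open>Non-isolated vertices and orders up to seven\<close>

lemma Union_eq_non_isolated: "E \<subseteq> pairs V \<Longrightarrow> \<Union>E = {v \<in> V. nb E v \<noteq> {}}"
proof
  assume E: "E \<subseteq> pairs V"
  show "\<Union>E \<subseteq> {v \<in> V. nb E v \<noteq> {}}"
  proof
    fix v assume "v \<in> \<Union>E"
    then obtain e where e: "e \<in> E" "v \<in> e" by auto
    then have "e \<in> pairs V" using E by auto
    then obtain a b where "e = {a, b}" "a \<in> V" "b \<in> V" by (auto elim: pairsE)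
    then show "v \<in> {v \<in> V. nb E v \<noteq> {}}" using e by (auto simp: nb_def insert_commute)
  qed
  show "{v \<in> V. nb E v \<noteq> {}} \<subseteq> \<Union>E" by (auto simp: nb_def)
qed

lemma card_Union_pairs: "E \<subseteq> pairs V \<Longrightarrow> card (\<Union>E) \<le> 2 * card E"
proof (cases "finite E")
  case True
  assume "E \<subseteq> pairs V"
  then have "(\<Sum>e\<in>E. card e) = (\<Sum>e\<in>E. 2)" by (intro sum.cong) (auto simp: pairs_def)
  then show ?thesis using card_Union_le_sum_card[of E] by simp
next
  case False
  assume "E \<subseteq> pairs V"
  then have "\<not> finite (\<Union>E)" using False finite_UnionD by auto
  then show ?thesis by simp
qed

text \<open>There are at most two edges, so four isolated vertices remain unless \<open>E\<close>
  consists of two disjoint edges on seven vertices.\<close>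

lemma good_small:
  assumes "finite V" "E \<subseteq> pairs V" "card E + 5 = card V" "card V \<le> 7"
  shows "good V E"
proof (cases "card (\<Union>E) + 4 \<le> card V")
  case True
  then show ?thesis by (rule good_four_isolated[OF assms(1,2)]) (use assms(3,4) in auto)
next
  case False
  with card_Union_pairs[OF assms(2)] assms(3,4) have c: "card E = 2" by linarith
  then obtain e f where ef: "E = {e, f}" "e \<noteq> f" by (auto simp: card_2_iff)
  then obtain a b c d where ab: "e = {a, b}" "a \<noteq> b" "a \<in> V" "b \<in> V"
      and cd: "f = {c, d}" "c \<noteq> d" "c \<in> V" "d \<in> V"
    using assms(2) by (metis insert_subset pairsE)
  have "\<Union>E = {a, b, c, d}" using ef ab cd by auto
  then have "card {a, b, c, d} \<ge> 4" using False c assms(3) by simp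
  moreover have "card {a, b, c, d} \<le> 3" if "\<not> distinct [a, b, c, d]"
  proof -
    have "card (set [a, b, c, d]) \<noteq> length [a, b, c, d]" using that card_distinct by blast
    moreover have "card (set [a, b, c, d]) \<le> length [a, b, c, d]" by (rule card_length)
    ultimately show ?thesis by simp
  qed
  ultimately have "distinct [a, b, c, d]" by linarith
  then show ?thesis
    using ef ab cd assms c by (intro good_2K2[of V a b c d]) auto
qed

section \<open>Complements of maximum degree at most one\<close>

text \<open>Distinct edges of a matching are disjoint, so one end of each of three edges yields a
  triple for \<open>good_step\<close> with degree sum three.\<close>

lemma good_matching:
  fixes V :: "'a set"
  assumes IH: "\<And>(V' :: 'a set) E'. finite V' \<Longrightarrow> card V' < card V \<Longrightarrow> E' \<subseteq> pairs V' \<Longrightarrow>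
      card E' + 5 \<le> card V' \<Longrightarrow> good V' E'"
    and V: "finite V" "E \<subseteq> pairs V" "card E + 5 \<le> card V" "card E \<ge> 3"
    and deg: "\<forall>v\<in>V. card (nb E v) \<le> 1"
  shows "good V E"
proof -
  have fin: "finite (nb E v)" for v
    using finite_subset[OF nb_subset[OF V(2)]] V(1) by auto
  have uniq: "u = w" if "u \<in> nb E v" "w \<in> nb E v" for u v w
  proof -
    have "v \<in> nb E u" using that(1) nb_sym by fast
    then have "v \<in> V" using nb_subset[OF V(2)] by auto
    then show ?thesis
      using deg that card_le_Suc0_iff_eq[OF fin[of v]] by auto
  qed
  obtain F where "F \<subseteq> E" "card F = 3" using V(4) by (meson obtain_subset_with_card_n)
  then obtain e1 e2 e3 where e: "e1 \<in> E" "e2 \<in> E" "e3 \<in> E" "e1 \<noteq> e2" "e1 \<noteq> e3" "e2 \<noteq> e3"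
    by (auto simp: card_3_iff)
  obtain c c' where c: "e1 = {c, c'}" "c \<in> V" using V(2) e(1) by (blast elim: pairsE)
  obtain x x' where x: "e2 = {x, x'}" "x \<in> V" using V(2) e(2) by (blast elim: pairsE)
  obtain y y' where y: "e3 = {y, y'}" "y \<in> V" using V(2) e(3) by (blast elim: pairsE)
  have mem: "c' \<in> nb E c" "x' \<in> nb E x" "y' \<in> nb E y"
    using e c x y by (simp_all add: nb_def insert_commute)
  have nb: "nb E c = {c'}" "nb E x = {x'}" "nb E y = {y'}"
    using mem uniq by blast+
  have nb': "c \<in> nb E c'" "x \<in> nb E x'" "y \<in> nb E y'"
    using e c x y by (simp_all add: nb_def)
  have ne: "c \<noteq> x" "c \<noteq> y" "x \<noteq> y"
    using nb e c(1) x(1) y(1) by auto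
  have ne': "c' \<noteq> x'" "c' \<noteq> y'" "x' \<noteq> y'"
    using uniq nb' ne by blast+
  have ne'': "c \<noteq> x'" "c \<noteq> y'" "x \<noteq> y'"
  proof -
    have "{p, p'} = {q, q'}" if "p = q'" "nb E p = {p'}" "q \<in> nb E q'" for p p' q q' :: 'a
      using that by auto
    then show "c \<noteq> x'" "c \<noteq> y'" "x \<noteq> y'"
      using nb nb' e(4-6) c(1) x(1) y(1) by metis+
  qed
  show ?thesis
  proof (rule good_step[OF IH V(1-3) c(2) x(2) y(2) ne])
    have "c \<notin> nb E x" "c \<notin> nb E y" "x \<notin> nb E y" using nb ne'' by auto
    then show "{c, x} \<notin> E" "{c, y} \<notin> E" "{x, y} \<notin> E" by (simp_all add: nb_def)
  qed (use nb ne' in auto)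
qed

section \<open>Complements with a vertex of degree at least two\<close>

text \<open>If \<open>E\<close> is not good, no triple meets the conditions of
  \<open>good_step\<close>. This first bounds all degrees by 2 and then confines all edges to the
  ball of radius two around a vertex \<open>c\<close> of degree 2, which leaves only graphs with an
  explicit orientation.\<close>

lemma good_branching:
  fixes V :: "'a set"
  assumes IH: "\<And>(V' :: 'a set) E'. finite V' \<Longrightarrow> card V' < card V \<Longrightarrow> E' \<subseteq> pairs V' \<Longrightarrow>
      card E' + 5 \<le> card V' \<Longrightarrow> good V' E'"
    and V: "finite V" "E \<subseteq> pairs V" "card E + 5 = card V" "card E \<ge> 3"
    and c0: "\<exists>v\<in>V. card (nb E v) \<ge> 2"
  shows "good V E"
proof (rule ccontr)
  assume ng: "\<not> good V E"
  have fin: "finite (nb E v)" for v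
    using finite_subset[OF nb_subset[OF V(2)]] V(1) by auto
  have finE: "finite E" using finite_subset[OF V(2) finite_pairs[OF V(1)]] .
  have nbV: "u \<in> V \<and> u \<noteq> v" if "u \<in> nb E v" for u v
    using nb_subset[OF V(2)] that by auto
  obtain S and f :: "'a \<Rightarrow> nat" where S: "S \<subseteq> V" "card S = 5" "inj_on f S"
      "\<forall>v\<in>S. card (nb E v) \<le> 1" "\<forall>u v. {u, v} \<in> E \<longrightarrow> f u = f v"
    using forest_roots[OF V(1,2), of 5] V(3) by auto
  \<comment> \<open>Vertices of different colours lie in different components, hence at distance at
    least 3.\<close>
  have sep: "{u, v} \<notin> E \<and> nb E u \<inter> nb E v = {} \<and> u \<noteq> v" if "f u \<noteq> f v" for u v
  proof -
    have nbf: "f w = f z" if "w \<in> nb E z" for w z using that S(5) by (simp add: nb_def)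
    have "u \<notin> nb E v" using nbf[of u v] that by auto
    moreover have "nb E u \<inter> nb E v = {}"
    proof (rule ccontr)
      assume "\<not> ?thesis"
      then obtain w where "w \<in> nb E u" "w \<in> nb E v" by auto
      then show False using nbf[of w u] nbf[of w v] that by simp
    qed
    ultimately show ?thesis using that by (auto simp: nb_def)
  qed
  \<comment> \<open>\<open>f\<close> is injective on \<open>S\<close>, so at most one element of
    \<open>S\<close> has the colour of \<open>c\<close>.\<close>
  have others: "\<exists>R \<subseteq> S. card R = 4 \<and> (\<forall>s\<in>R. f s \<noteq> f c)" for c
  proof (cases "\<exists>s\<in>S. f s = f c")
    case True
    then obtain s where s: "s \<in> S" "f s = f c" by auto
    have "card (S - {s}) = 4" using S(2) s(1) by simp
    moreover have "\<forall>r\<in>S - {s}. f r \<noteq> f c" using s S(3) by (auto simp: inj_on_def)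
    ultimately show ?thesis by (intro exI[of _ "S - {s}"]) auto
  next
    case False
    obtain R where "R \<subseteq> S" "card R = 4" using S(2) obtain_subset_with_card_n[of 4 S] by auto
    then show ?thesis using False by auto
  qed
  \<comment> \<open>A degree sum of 3 or more would let \<open>good_step\<close> apply to
    \<open>c\<close>, \<open>x\<close> and any further element \<open>y\<close> of \<open>S\<close>
    with a colour other than that of \<open>c\<close>.\<close>
  have total: "card (nb E c) + card (nb E x) \<le> 2" if "c \<in> V" "x \<in> S" "f x \<noteq> f c" for c x
  proof (rule ccontr)
    assume big: "\<not> ?thesis"
    obtain R where R: "R \<subseteq> S" "card R = 4" "\<forall>s\<in>R. f s \<noteq> f c" using others by blast
    then have "\<not> R \<subseteq> {x}" using card_mono[of "{x}" R] by auto
    then obtain y where y: "y \<in> R" "y \<noteq> x" by auto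
    then have "f x \<noteq> f y" using S(3) that(2) R(1) by (auto simp: inj_on_def)
    moreover have "f c \<noteq> f x" "f c \<noteq> f y" using that(3) R(3) y(1) by auto
    moreover have "x \<in> V" "y \<in> V" "card (nb E x) \<le> 1" "card (nb E y) \<le> 1"
      using S(1,4) R(1) y(1) that(2) by auto
    ultimately have "good V E"
      using good_step[OF IH V(1,2) _ that(1), of x y] V(3) sep big by simp
    with ng show False ..
  qed
  have le2: "card (nb E v) \<le> 2" if "v \<in> V" for v
  proof -
    obtain R where R: "R \<subseteq> S" "card R = 4" "\<forall>s\<in>R. f s \<noteq> f v" using others by blast
    then have "R \<noteq> {}" by auto
    then obtain s where "s \<in> S" "f s \<noteq> f v" using R by auto
    then show ?thesis using total that by fastforce
  qed
  then obtain c where c: "c \<in> V" "card (nb E c) = 2" using c0 by (meson le_antisym)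
  obtain R where R: "R \<subseteq> S" "card R = 4" "\<forall>s\<in>R. f s \<noteq> f c" using others by blast
  \<comment> \<open>\<open>c\<close> alone already exhausts the bound of
    \<open>total\<close>.\<close>
  have R0: "nb E s = {}" if "s \<in> R" for s
    using total[OF c(1), of s] that R c(2) fin by auto
  have "R \<noteq> {}" using R(2) by auto
  then obtain y where y: "y \<in> R" by auto
  obtain a b where ab: "nb E c = {a, b}" "a \<noteq> b" using c(2) by (auto simp: card_2_iff)
  have abV: "a \<in> V" "b \<in> V" "a \<noteq> c" "b \<noteq> c" using nbV ab by auto
  have cab: "c \<in> nb E a" "c \<in> nb E b" using ab nb_sym by fast+
  \<comment> \<open>\<open>B\<close> is the ball of radius two around \<open>c\<close>; as all
    degrees are at most 2, it has at most five vertices.\<close>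
  define B where "B = {c, a, b} \<union> (nb E a - {c}) \<union> (nb E b - {c})"
  have one: "card (nb E a - {c}) \<le> 1" "card (nb E b - {c}) \<le> 1"
    using cab fin le2[OF abV(1)] le2[OF abV(2)] by (simp_all add: card_Diff_singleton)
  have "card B \<le> card {c, a, b} + card (nb E a - {c}) + card (nb E b - {c})"
    unfolding B_def by (meson add_le_mono card_Un_le le_refl order_trans)
  then have cB: "card B \<le> 5" using one card_insert_le_m1[of 3 "{a, b}" c] ab by simp
  have finB: "finite B" using fin by (auto simp: B_def)
  \<comment> \<open>Outside \<open>B\<close> the distance from \<open>c\<close> is at least 3, so
    \<open>c\<close>, \<open>x\<close> and the isolated vertex \<open>y\<close> form a triple of
    degree sum at least 3.\<close>
  have far: "good V E" if "x \<in> V" "x \<notin> B" "nb E x \<noteq> {}"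
      "card (nb E x) \<le> 1 \<or> card (nb E x) = 2 \<and> (\<exists>z\<in>nb E x. card (nb E z) \<ge> 2)" for x
  proof -
    have "card (nb E x) > 0" using that(3) fin by (simp add: card_gt_0_iff)
    have "x \<noteq> y" using that(3) R0[OF y] by auto
    have "c \<noteq> y" using R0[OF y] c(2) by auto
    have "y \<in> V" using y R(1) S(1) by auto
    have x: "x \<noteq> c" "x \<noteq> a" "x \<noteq> b" "x \<notin> nb E a" "x \<notin> nb E b"
      using that(2) by (auto simp: B_def)
    then have "a \<notin> nb E x" "b \<notin> nb E x" using nb_sym by fast+
    moreover have "x \<notin> nb E c" using x ab(1) by simp
    then have "{c, x} \<notin> E" by (simp add: nb_def insert_commute)
    moreover have "{c, y} \<notin> E" "{x, y} \<notin> E" using R0[OF y] by (auto simp: nb_def)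
    ultimately show ?thesis
      using good_step[OF IH V(1,2) _ c(1) that(1) \<open>y \<in> V\<close>] V(3) x(1) \<open>x \<noteq> y\<close> \<open>c \<noteq> y\<close>
        ab(1) R0[OF y] c(2) \<open>card (nb E x) > 0\<close> that(4) by simp
  qed
  \<comment> \<open>By \<open>far\<close>, a non-isolated \<open>x\<close> outside \<open>B\<close>
    has degree 2 and only neighbours \<open>z\<close> of degree 1. Such a \<open>z\<close> is not
    outside \<open>B\<close> either, again by \<open>far\<close>; inside \<open>B\<close> it would
    be adjacent to \<open>a\<close> or \<open>b\<close> besides \<open>x\<close>.\<close>
  have WB: "\<Union>E \<subseteq> B"
  proof (rule ccontr)
    assume "\<not> ?thesis"
    then obtain x where x: "x \<in> V" "nb E x \<noteq> {}" "x \<notin> B"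
      using Union_eq_non_isolated[OF V(2)] by auto
    then have x2: "card (nb E x) = 2"
      using far[of x] ng le2[of x] by linarith
    obtain z where z: "z \<in> nb E x" using x(2) by auto
    have "card (nb E z) \<ge> 2"
    proof (rule ccontr)
      assume le: "\<not> ?thesis"
      have xz: "x \<in> nb E z" using z nb_sym by fast
      then have "z \<in> B" using far[of z] le ng nbV[OF z] by auto
      moreover have "z \<noteq> c" "z \<noteq> a" "z \<noteq> b" using xz x(3) ab by (auto simp: B_def)
      ultimately have "a \<in> nb E z \<or> b \<in> nb E z" using nb_sym unfolding B_def by fast
      then obtain w where "w \<in> nb E z" "w = a \<or> w = b" by auto
      moreover have "x \<noteq> a" "x \<noteq> b" using x(3) by (auto simp: B_def)
      ultimately have "card {w, x} = 2" "{w, x} \<subseteq> nb E z" using xz by auto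
      then show False using le card_mono[OF fin, of "{w, x}" z] by simp
    qed
    then show False using far[of x] x x2 z ng by auto
  qed
  have finW: "finite (\<Union>E)" using WB finB finite_subset by auto
  have WV: "\<Union>E \<subseteq> V" using V(2) by (auto simp: pairs_def)
  have W5: "card (\<Union>E) \<le> 5" using card_mono[OF finB WB] cB by simp
  have "2 * card E = (\<Sum>v\<in>\<Union>E. card (nb E v))"
  proof -
    have "(\<Sum>v\<in>\<Union>E. card (nb E v)) = (\<Sum>v\<in>V. card (nb E v))"
      using Union_eq_non_isolated[OF V(2)] V(1) by (intro sum.mono_neutral_left) auto
    then show ?thesis using sum_card_nb[OF V(1,2)] by simp
  qed
  also have "\<dots> \<le> (\<Sum>v\<in>\<Union>E. 2)" using le2 WV by (intro sum_mono) auto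
  finally have E5: "card E \<le> 5" using W5 by simp
  \<comment> \<open>Otherwise at least five vertices are isolated, and the order
    \<open>card E + 5\<close> is at most ten, so \<open>good_five_isolated\<close> applies.\<close>
  have W: "card (\<Union>E) > card E"
  proof (rule ccontr)
    assume "\<not> ?thesis"
    then show False using good_five_isolated[OF V(1,2)] V(3,4) E5 ng by simp
  qed
  have "a \<in> nb E c" "b \<in> nb E c" using ab by simp_all
  then have abc: "{c, a} \<in> E" "{c, b} \<in> E" by (simp_all add: nb_def insert_commute)
  have cabW: "{c, a, b} \<subseteq> \<Union>E" and c3: "card {c, a, b} = 3" using abc ab abV by auto
  have WD: "card (\<Union>E - {c, a, b}) = card (\<Union>E) - 3"
    using card_Diff_subset[OF _ cabW] c3 by simp
  have outer: "v \<in> nb E a \<or> v \<in> nb E b" if "v \<in> \<Union>E - {c, a, b}" for v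
    using WB that by (auto simp: B_def)
  have eqE: "E = F" if "F \<subseteq> E" "card F = card E" for F
    using card_subset_eq[OF finE that] by simp
  consider "card E = 3" | "card E = 4" using V(4) W W5 by linarith
  then show False
  proof cases
    case 1
    then have "card (\<Union>E - {c, a, b}) \<noteq> 0" using WD W by linarith
    then have "\<Union>E - {c, a, b} \<noteq> {}" by (metis card.empty)
    then obtain v where v: "v \<in> \<Union>E - {c, a, b}" by auto
    \<comment> \<open>The edges \<open>v p\<close>, \<open>p c\<close>, \<open>c q\<close> are three
      distinct ones and hence all of \<open>E\<close>.\<close>
    have P4: "good V E" if "v \<in> nb E p" "{p, q} = {a, b}" "p \<noteq> q" for p q
    proof -
      have pq: "p = a \<and> q = b \<or> p = b \<and> q = a" using that(2) by (auto simp: doubleton_eq_iff)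
      have "{{v, p}, {p, c}, {c, q}} \<subseteq> E"
        using that(1) abc pq by (auto simp: nb_def insert_commute)
      moreover have "card {{v, p}, {p, c}, {c, q}} = 3"
        using pq v abV ab(2) by (auto simp: doubleton_eq_iff card_insert_if)
      ultimately have "E = {{v, p}, {p, c}, {c, q}}" using eqE 1 by simp
      then show ?thesis
        using pq v abV ab(2) V c(1) 1 WV by (intro good_P4[of V v p c q]) auto
    qed
    from outer[OF v] show False using P4[of a b] P4[of b a] ab(2) ng by auto
  next
    case 2
    then have "card (\<Union>E - {c, a, b}) = 2" using WD W W5 by simp
    then obtain u v where "\<Union>E - {c, a, b} = {u, v}" "u \<noteq> v" by (auto simp: card_2_iff)
    then have uv: "u \<in> \<Union>E - {c, a, b}" "v \<in> \<Union>E - {c, a, b}" "u \<noteq> v" by auto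
    \<comment> \<open>Together with \<open>c\<close>, the vertices \<open>u\<close> and
      \<open>v\<close> would give \<open>p\<close> degree 3. So they hang at different ends, and
      \<open>E\<close> is a path on five vertices.\<close>
    have one': "\<not> (u \<in> nb E p \<and> v \<in> nb E p)" if "p = a \<or> p = b" for p
    proof
      assume "u \<in> nb E p \<and> v \<in> nb E p"
      then have "{u, v} \<subseteq> nb E p - {c}" using uv by auto
      then show False
        using card_mono[of "nb E p - {c}" "{u, v}"] fin uv(3) one that by auto
    qed
    have P5: "good V E" if "u \<in> nb E p" "v \<in> nb E q" "{p, q} = {a, b}" "p \<noteq> q" for p q
    proof -
      have pq: "p = a \<and> q = b \<or> p = b \<and> q = a" using that(3) by (auto simp: doubleton_eq_iff)
      have "{{u, p}, {p, c}, {c, q}, {q, v}} \<subseteq> E"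
        using that(1,2) abc pq by (auto simp: nb_def insert_commute)
      moreover have "card {{u, p}, {p, c}, {c, q}, {q, v}} = 4"
        using pq uv abV ab(2) by (auto simp: doubleton_eq_iff card_insert_if)
      ultimately have "E = {{u, p}, {p, c}, {c, q}, {q, v}}" using eqE 2 by simp
      then show ?thesis
        using pq uv abV ab(2) V c(1) 2 WV by (intro good_P5[of V u p c q v]) auto
    qed
    from outer[OF uv(1)] outer[OF uv(2)] one'[of a] one'[of b] show False
      using P5[of a b] P5[of b a] ab(2) ng by auto
  qed
qed

section \<open>Induction on the order\<close>

lemma good_if_few_edges:
  assumes "finite V" "E \<subseteq> pairs V" "card E + 5 \<le> card V"
  shows "good V E"
  using assms
proof (induction "card V" arbitrary: V E rule: less_induct)
  case less
  let ?n = "card V"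
  have finE: "finite E" using finite_subset[OF less.prems(2) finite_pairs[OF less.prems(1)]] .
  \<comment> \<open>There are enough pairs to enlarge \<open>E\<close> to exactly
    \<open>?n - 5\<close> edges. The equality ties the order to the number of edges, which keeps the
    explicit cases finite in number.\<close>
  have "2 * (?n - 5) \<le> ?n * (?n - 1)"
    using less.prems(3) by (intro order_trans[OF mult_le_mono[of 2 ?n "?n - 5" "?n - 1"]]) auto
  then have "?n - 5 \<le> card (pairs V)"
    unfolding card_pairs[OF less.prems(1)] choose_two by linarith
  moreover have "card E \<le> ?n - 5" using less.prems(3) by simp
  ultimately obtain F where F: "E \<subseteq> F" "F \<subseteq> pairs V" "card F = ?n - 5"
    using exists_subset_between[of E "?n - 5" "pairs V"] less.prems(2) finite_pairs[OF less.prems(1)]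
    by blast
  have IH: "good V' E'" if "finite V'" "card V' < card V" "E' \<subseteq> pairs V'" "card E' + 5 \<le> card V'"
    for V' :: "'a set" and E'
    using less.hyps that by blast
  have cF: "card F + 5 = card V" using F(3) less.prems(3) by simp
  have "good V F"
  proof (cases "?n \<le> 7")
    case True
    then show ?thesis using good_small less.prems(1) F(2) cF by blast
  next
    case False
    then have F3: "card F \<ge> 3" using cF by simp
    show ?thesis
    proof (cases "\<forall>v\<in>V. card (nb F v) \<le> 1")
      case True
      then show ?thesis using good_matching[OF IH less.prems(1) F(2) _ F3] cF by simp
    next
      case False
      then have "\<exists>v\<in>V. 2 \<le> card (nb F v)" by fastforce
      then show ?thesis using good_branching[OF IH less.prems(1) F(2) cF F3] by simp
    qed
  qed
  then show ?case using F(1) good_antimono by blast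
qed

subsection \<open>Orientations and diameter\<close>

text \<open>Edges not yet oriented by \<open>D\<close> are directed towards the larger value of an
  injective numbering of the vertices.\<close>

lemma orientation_extends:
  fixes G :: "'a pair_pre_digraph"
  assumes "pair_graph G" and D: "D \<subseteq> parcs G" "D \<inter> D\<inverse> = {}"
  shows "\<exists>D'. is_orientation D' G \<and> D \<subseteq> parcs D'"
proof -
  interpret pair_graph G by fact
  obtain f :: "'a \<Rightarrow> nat" where f: "inj_on f (pverts G)"
    using finite_imp_inj_to_nat_seg[OF finite_verts] by auto
  define A where "A = D \<union> {(u, v) \<in> parcs G. (v, u) \<notin> D \<and> f u < f v}"
  have sym: "(v, u) \<in> parcs G" if "(u, v) \<in> parcs G" for u v
    using that pair_sym_arcs by (simp add: symmetric_def sym_def)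
  have "f u \<noteq> f v" if "(u, v) \<in> parcs G" for u v
    using that f wellformed[of "(u, v)"] no_loops[of "(u, v)"] by (auto simp: inj_on_eq_iff)
  then have "\<forall>u v. (u, v) \<in> parcs G \<longrightarrow> ((u, v) \<in> A) \<noteq> ((v, u) \<in> A)"
    using D sym unfolding A_def by (auto simp: linorder_neq_iff)
  moreover have "A \<subseteq> parcs G" using D unfolding A_def by auto
  ultimately have "is_orientation (G\<lparr>parcs := A\<rparr>) G"
    using is_orientation_iff[OF assms(1)] by simp
  moreover have "D \<subseteq> A" by (auto simp: A_def)
  ultimately show ?thesis by (intro exI[of _ "G\<lparr>parcs := A\<rparr>"]) simp
qed

lemma digraph_dist_le:
  assumes "pre_digraph.apath D u p v"
  shows "digraph_dist D u v \<le> enat (length p)"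
  unfolding digraph_dist_def using assms by (intro INF_lower) simp

lemma digraph_diameter_orientation:
  fixes D :: "'a pair_pre_digraph"
  assumes wf: "parcs D \<subseteq> pverts D \<times> pverts D" and anti: "parcs D \<inter> (parcs D)\<inverse> = {}"
    and two: "\<forall>u\<in>pverts D. \<forall>v\<in>pverts D. u \<noteq> v \<longrightarrow> (u, v) \<in> parcs D \<union> parcs D O parcs D"
    and ne: "a \<in> pverts D" "b \<in> pverts D" "a \<noteq> b"
  shows "digraph_diameter (with_proj D) = 2"
proof (rule antisym)
  interpret pair_wf_digraph D using wf by unfold_locales auto
  have noloop: "(u, u) \<notin> parcs D" for u using anti by auto
  have "digraph_dist (with_proj D) u v \<le> 2" if uv: "u \<in> pverts D" "v \<in> pverts D" for u v
  proof -
    have "\<exists>p. apath u p v \<and> length p \<le> 2"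
    proof (cases "u = v")
      case True
      then have "apath u [] v" using uv by (simp add: apath_def awalk_Nil_iff)
      then show ?thesis by (intro exI[of _ "[]"]) simp
    next
      case False
      then have "(u, v) \<in> parcs D \<or> (\<exists>w. (u, w) \<in> parcs D \<and> (w, v) \<in> parcs D)"
        using two uv by blast
      then show ?thesis
      proof
        assume "(u, v) \<in> parcs D"
        then have "apath u [(u, v)] v"
          using False uv by (simp add: apath_def awalk_def)
        then show ?thesis by (intro exI[of _ "[(u, v)]"]) simp
      next
        assume "\<exists>w. (u, w) \<in> parcs D \<and> (w, v) \<in> parcs D"
        then obtain w where w: "(u, w) \<in> parcs D" "(w, v) \<in> parcs D" by auto
        then have "u \<noteq> w" "w \<noteq> v" using noloop by auto
        then have "apath u [(u, w), (w, v)] v"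
          using w False uv by (simp add: apath_def awalk_def)
        then show ?thesis by (intro exI[of _ "[(u, w), (w, v)]"]) simp
      qed
    qed
    then obtain p where "apath u p v" "length p \<le> 2" by auto
    then have "digraph_dist (with_proj D) u v \<le> enat (length p)" by (intro digraph_dist_le)
    also have "\<dots> \<le> enat 2" using \<open>length p \<le> 2\<close> by simp
    finally show ?thesis by (simp add: numeral_eq_enat)
  qed
  then show "digraph_diameter (with_proj D) \<le> 2"
    unfolding digraph_diameter_def by (intro SUP_least) simp
  \<comment> \<open>At most one of \<open>(a, b)\<close> and \<open>(b, a)\<close> is an arc; the
    other ordered pair has distance at least 2.\<close>
  obtain u v where uv: "u \<in> pverts D" "v \<in> pverts D" "u \<noteq> v" "(u, v) \<notin> parcs D"
    using ne anti by blast
  have "enat 2 \<le> digraph_dist (with_proj D) u v"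
    unfolding digraph_dist_def
  proof (rule INF_greatest)
    fix p assume "p \<in> {p. apath u p v}"
    then have p: "awalk u p v" by (simp add: apath_def)
    have "p \<noteq> []" using p uv(3) by (auto simp: awalk_def)
    moreover have "p \<noteq> [e]" for e
      using p uv(4) by (auto simp: awalk_def)
    ultimately have "length p \<ge> 2" by (cases p; cases "tl p") auto
    then show "enat 2 \<le> enat (length p)" by simp
  qed
  also have "\<dots> \<le> digraph_diameter (with_proj D)"
    unfolding digraph_diameter_def using uv by (intro SUP_upper2[of u] SUP_upper2[of v]) auto
  finally show "2 \<le> digraph_diameter (with_proj D)" by (simp add: numeral_eq_enat)
qed

theorem theorem1:
  fixes G :: "'a pair_pre_digraph" and n :: nat
  assumes "pair_graph G"
    and "card (pverts G) = n"
    and "n \<ge> 5"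
    and "int (card (edges G)) \<ge> int (n choose 2) - int n + 5"
  shows "\<exists>D. is_orientation D G \<and> digraph_diameter (with_proj D) = 2"
proof -
  interpret pair_graph G by fact
  have fin: "finite (pverts G)" by (rule finite_verts)
  have wf: "u \<in> pverts G \<and> v \<in> pverts G \<and> u \<noteq> v" if "(u, v) \<in> parcs G" for u v
    using that wellformed[of "(u, v)"] no_loops[of "(u, v)"] by auto
  have edges: "edges G \<subseteq> pairs (pverts G)"
    unfolding edges_def using wf by (auto simp: doubleton_in_pairs)
  let ?E = "pairs (pverts G) - edges G"
  \<comment> \<open>Edges and non-edges together are all pairs, so the lower bound on the size of
    \<open>G\<close> becomes the bound \<open>n - 5\<close> on the number of non-edges.\<close>
  have "card ?E + card (edges G) = n choose 2"
    using card_Diff_subset[OF finite_subset[OF edges finite_pairs[OF fin]] edges]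
      card_mono[OF finite_pairs[OF fin] edges] card_pairs[OF fin] assms(2) by simp
  then have "card ?E + 5 \<le> card (pverts G)" using assms(2,4) by linarith
  then have "good (pverts G) ?E" by (intro good_if_few_edges fin) auto
  then obtain D where D: "D \<subseteq> pverts G \<times> pverts G" "D \<inter> D\<inverse> = {}"
      "\<forall>(u, v)\<in>D. {u, v} \<notin> ?E"
      "\<forall>u\<in>pverts G. \<forall>v\<in>pverts G. u \<noteq> v \<longrightarrow> (u, v) \<in> D \<union> D O D"
    unfolding good_def by blast
  have "D \<subseteq> parcs G"
  proof (rule subrelI)
    fix u v assume uv: "(u, v) \<in> D"
    then have "u \<noteq> v" using D(2) by auto
    then have "{u, v} \<in> edges G"
      using D(1,3) uv by (auto simp: doubleton_in_pairs)
    then obtain a b where "(a, b) \<in> parcs G" "{u, v} = {a, b}" by (auto simp: edges_def)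
    moreover have "(b, a) \<in> parcs G" if "(a, b) \<in> parcs G" for a b
      using that pair_sym_arcs by (simp add: symmetric_def sym_def)
    ultimately show "(u, v) \<in> parcs G" by (auto simp: doubleton_eq_iff)
  qed
  then obtain D' where D': "is_orientation D' G" "D \<subseteq> parcs D'"
    using orientation_extends[OF assms(1) _ D(2)] by blast
  obtain B where "B \<subseteq> pverts G" "card B = 2"
    using assms(2,3) obtain_subset_with_card_n[of 2 "pverts G"] by auto
  then obtain a b where ab: "a \<in> pverts G" "b \<in> pverts G" "a \<noteq> b" by (auto simp: card_2_iff)
  have or: "pverts D' = pverts G" "parcs D' \<subseteq> parcs G" "parcs D' \<inter> (parcs D')\<inverse> = {}"
    using D'(1) by (auto simp: is_orientation_def)
  have "digraph_diameter (with_proj D') = 2"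
  proof (rule digraph_diameter_orientation)
    show "parcs D' \<subseteq> pverts D' \<times> pverts D'" using or wf by auto
    show "\<forall>u\<in>pverts D'. \<forall>v\<in>pverts D'. u \<noteq> v \<longrightarrow> (u, v) \<in> parcs D' \<union> parcs D' O parcs D'"
      using D(4) D'(2) unfolding or(1) by blast
  qed (use or ab in auto)
  with D'(1) show ?thesis by blast
qed

end
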